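(* Let $(X,d)$ be a complete ultrametric space and let $T\colon X\to X$ be a mapping for which there exists $\beta$ with $0\le\beta<1$ such that $$d(Tx,Ty)\le\beta\max\{d(x,Ty),d(y,Tx)\}\quad\text{for all }x,y\in X.$$ Then $T$ has a unique fixed point.
   Context: An ultrametric space is a nonempty set $X$ with a function $d\colon X\times X\to[0,\infty)$ such that for all $x,y,z\in X$: $d(x,y)=0$ if and only if $x=y$; $d(x,y)=d(y,x)$; and $d(x,y)\le\max\{d(x,z),d(z,y)\}$. *)

theory Defs
  imports "HOL-Analysis.Analysis"
begin

(* As in Metric_space, nonnegativity and symmetry are also required for arguments outside M.
   This is no restriction: a distance given only on M can be extended by 0. *)
locale Ultrametric_space =
  fixes M :: "'a set" and d :: "'a \<Rightarrow> 'a \<Rightarrow> real"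
  assumes nonempty: "M \<noteq> {}"
    and nonneg: "\<And>x y. 0 \<le> d x y"
    and zero: "\<And>x y. \<lbrakk>x \<in> M; y \<in> M\<rbrakk> \<Longrightarrow> d x y = 0 \<longleftrightarrow> x = y"
    and commute: "\<And>x y. d x y = d y x"
    and ultra: "\<And>x y z. \<lbrakk>x \<in> M; y \<in> M; z \<in> M\<rbrakk> \<Longrightarrow> d x y \<le> max (d x z) (d z y)"

lemma Ultrametric_space_imp_Metric_space:
  assumes "Ultrametric_space M d"
  shows "Metric_space M d"
proof -
  interpret Ultrametric_space M d by fact
  show ?thesis
  proof
    fix x y z assume "x \<in> M" "y \<in> M" "z \<in> M"
    then show "d x z \<le> d x y + d y z"
      using ultra[of x z y] nonneg[of x y] nonneg[of y z] by linarith
  qed (use nonneg zero commute in auto)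
qed

end

theory Submission
  imports Defs
begin

text \<open>
  Fix any point and look at its Picard orbit. Putting \<open>y = T x\<close> in the contraction condition kills one
  of the two distances on the right, and the strong triangle inequality splits the other one,
  \<open>d x (T (T x))\<close>, into the old step \<open>d x (T x)\<close> and the new step \<open>d (T x) (T (T x))\<close>. The new
  step cannot be the larger of the two, since \<open>\<beta> < 1\<close>, and so every step is at most \<open>\<beta>\<close> times the
  previous one (\<open>step_shrinks\<close>). This is where the ultrametric matters: the ordinary
  triangle inequality would only give the ratio \<open>\<beta> / (1 - \<beta>)\<close>, which is useless for \<open>\<beta> \<ge> 1/2\<close>.

  In an ultrametric space it is enough for the Cauchy property that the steps tend to \<open>0\<close>
  (\<open>MCauchy_if_steps_vanish\<close>). So the orbit converges. Its limit \<open>z\<close> is fixed, although \<open>T\<close> need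
  not be continuous: if \<open>T z \<noteq> z\<close>, then the orbit comes closer to \<open>z\<close> than \<open>T z\<close> is, and
  all terms but \<open>d z (T z)\<close> drop out of the maxima, which leaves the contradiction
  \<open>d z (T z) \<le> \<beta> * d z (T z)\<close> (\<open>fixed_if_well_approximated\<close>).
\<close>

context Ultrametric_space
begin

lemma dist_le_if_steps_le:
  assumes "range \<sigma> \<subseteq> M" and "\<And>k. N \<le> k \<Longrightarrow> d (\<sigma> k) (\<sigma> (Suc k)) \<le> c" and "N \<le> n"
  shows "d (\<sigma> N) (\<sigma> n) \<le> c"
  using \<open>N \<le> n\<close>
proof (induction n rule: dec_induct)
  case base
  have "d (\<sigma> N) (\<sigma> N) = 0"
    using assms(1) zero by blast
  also have "0 \<le> c"
    using assms(2)[of N] nonneg[of "\<sigma> N" "\<sigma> (Suc N)"] by linarith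
  finally show ?case .
next
  case (step k)
  have "d (\<sigma> N) (\<sigma> (Suc k)) \<le> max (d (\<sigma> N) (\<sigma> k)) (d (\<sigma> k) (\<sigma> (Suc k)))"
    using assms(1) by (intro ultra) auto
  then show ?case
    using step assms(2)[of k] by linarith
qed

text \<open>A chain of steps covers no more distance than its longest step, however many steps there are.
  So, unlike in a general metric space, the step lengths need not be summable.\<close>

lemma MCauchy_if_steps_vanish:
  assumes "range \<sigma> \<subseteq> M" and "(\<lambda>n. d (\<sigma> n) (\<sigma> (Suc n))) \<longlonglongrightarrow> 0"
  shows "Metric_space.MCauchy M d \<sigma>"
proof -
  interpret Metric_space M d
    by (intro Ultrametric_space_imp_Metric_space Ultrametric_space_axioms)
  show ?thesis
    unfolding MCauchy_def
  proof (intro conjI allI impI)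
    fix \<epsilon> :: real assume "0 < \<epsilon>"
    then have "\<forall>\<^sub>F n in sequentially. d (\<sigma> n) (\<sigma> (Suc n)) < \<epsilon> / 2"
      using assms(2) by (intro order_tendstoD(2)) auto
    then obtain N where N: "\<And>n. N \<le> n \<Longrightarrow> d (\<sigma> n) (\<sigma> (Suc n)) \<le> \<epsilon> / 2"
      unfolding eventually_sequentially by (meson less_imp_le)
    have "d (\<sigma> n) (\<sigma> m) < \<epsilon>" if "N \<le> n" "N \<le> m" for n m
    proof -
      have "d (\<sigma> n) (\<sigma> m) \<le> max (d (\<sigma> n) (\<sigma> N)) (d (\<sigma> N) (\<sigma> m))"
        using assms(1) by (intro ultra) auto
      also have "\<dots> \<le> \<epsilon> / 2"
        using dist_le_if_steps_le[OF assms(1) N] that commute by (metis max.bounded_iff)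
      finally show ?thesis
        using \<open>0 < \<epsilon>\<close> by linarith
    qed
    then show "\<exists>N. \<forall>n n'. N \<le> n \<longrightarrow> N \<le> n' \<longrightarrow> d (\<sigma> n) (\<sigma> n') < \<epsilon>"
      by blast
  qed (use assms(1) in auto)
qed

end

locale ultrametric_Chatterjea_map = Ultrametric_space M d
  for M :: "'a set" and d :: "'a \<Rightarrow> 'a \<Rightarrow> real" +
  fixes T :: "'a \<Rightarrow> 'a" and \<beta> :: real
  assumes maps: "x \<in> M \<Longrightarrow> T x \<in> M"
    and \<beta>_nonneg: "0 \<le> \<beta>" and \<beta>_less_1: "\<beta> < 1"
    and contraction: "\<lbrakk>x \<in> M; y \<in> M\<rbrakk> \<Longrightarrow> d (T x) (T y) \<le> \<beta> * max (d x (T y)) (d y (T x))"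
begin

text \<open>The absorption principle that makes \<open>\<beta>\<close> itself, and not only \<open>\<beta> < 1/2\<close>, small enough: the
  left-hand side can be dropped from the maximum on the right.\<close>

lemma absorb:
  assumes "b \<le> \<beta> * max a b" and "0 \<le> a"
  shows "b \<le> \<beta> * a"
proof (cases "b \<le> a")
  case True
  then show ?thesis
    using assms(1) by (simp add: max_def split: if_splits)
next
  case False
  then have "\<beta> * b < 1 * b"
    using \<open>0 \<le> a\<close> \<beta>_less_1 by (intro mult_strict_right_mono) auto
  then show ?thesis
    using False assms(1) by simp
qed

lemma step_shrinks:
  assumes "x \<in> M"
  shows "d (T x) (T (T x)) \<le> \<beta> * d x (T x)"
proof -
  have "d (T x) (T (T x)) \<le> \<beta> * max (d x (T (T x))) (d (T x) (T x))"
    using assms maps by (intro contraction) auto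
  also have "\<dots> \<le> \<beta> * max (d x (T x)) (d (T x) (T (T x)))"
  proof (intro mult_left_mono \<beta>_nonneg max.boundedI)
    show "d x (T (T x)) \<le> max (d x (T x)) (d (T x) (T (T x)))"
      using assms maps by (intro ultra) auto
    have "d (T x) (T x) = 0"
      using assms maps zero by blast
    then show "d (T x) (T x) \<le> max (d x (T x)) (d (T x) (T (T x)))"
      by (simp add: le_max_iff_disj nonneg)
  qed
  finally show ?thesis
    using absorb nonneg by blast
qed

lemma orbit_in: "x \<in> M \<Longrightarrow> (T ^^ n) x \<in> M"
  by (induction n) (auto simp: maps)

lemma orbit_steps_le:
  assumes "x \<in> M"
  shows "d ((T ^^ n) x) ((T ^^ Suc n) x) \<le> \<beta> ^ n * d x (T x)"
proof (induction n)
  case (Suc n)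
  have "d ((T ^^ Suc n) x) ((T ^^ Suc (Suc n)) x) \<le> \<beta> * d ((T ^^ n) x) ((T ^^ Suc n) x)"
    using step_shrinks[OF orbit_in[OF assms, of n]] by simp
  also have "\<dots> \<le> \<beta> * (\<beta> ^ n * d x (T x))"
    by (intro mult_left_mono Suc.IH \<beta>_nonneg)
  finally show ?case
    by (simp add: mult.assoc)
qed simp

lemma orbit_MCauchy:
  assumes "x \<in> M"
  shows "Metric_space.MCauchy M d (\<lambda>n. (T ^^ n) x)"
proof (rule MCauchy_if_steps_vanish)
  show "range (\<lambda>n. (T ^^ n) x) \<subseteq> M"
    using orbit_in[OF assms] by blast
  have lim: "(\<lambda>n. \<beta> ^ n * d x (T x)) \<longlonglongrightarrow> 0"
    using \<beta>_nonneg \<beta>_less_1 by (intro tendsto_mult_left_zero LIMSEQ_realpow_zero) auto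
  show "(\<lambda>n. d ((T ^^ n) x) ((T ^^ Suc n) x)) \<longlonglongrightarrow> 0"
  proof (rule tendsto_sandwich[OF _ _ tendsto_const lim])
    show "\<forall>\<^sub>F n in sequentially. 0 \<le> d ((T ^^ n) x) ((T ^^ Suc n) x)"
      by (intro always_eventually allI nonneg)
    show "\<forall>\<^sub>F n in sequentially. d ((T ^^ n) x) ((T ^^ Suc n) x) \<le> \<beta> ^ n * d x (T x)"
      by (intro always_eventually allI orbit_steps_le assms)
  qed
qed

text \<open>This replaces continuity of \<open>T\<close>: a single \<open>x\<close> that is closer to \<open>z\<close> than \<open>T z\<close> is, together
  with its image, gives a contradiction if \<open>T z \<noteq> z\<close>. In \<open>d z (T z) \<le> max (d z (T x)) (d (T x) (T z))\<close> the first distance is then too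
  small to attain the maximum, and the contraction condition bounds the second by
  \<open>\<beta> * d z (T z)\<close>.\<close>

lemma fixed_if_well_approximated:
  assumes "z \<in> M" and approx: "\<And>\<epsilon>. 0 < \<epsilon> \<Longrightarrow> \<exists>x\<in>M. d x z < \<epsilon> \<and> d (T x) z < \<epsilon>"
  shows "T z = z"
proof (rule ccontr)
  assume "T z \<noteq> z"
  define D where "D = d z (T z)"
  have "0 < D"
    using \<open>T z \<noteq> z\<close> \<open>z \<in> M\<close> maps zero[of z "T z"] nonneg[of z "T z"] unfolding D_def by force
  then obtain x where x: "x \<in> M" "d x z < D" "d (T x) z < D"
    using approx by blast
  have "d x (T z) \<le> max (d x z) (d z (T z))"
    using x \<open>z \<in> M\<close> maps by (intro ultra) auto
  then have "max (d x (T z)) (d z (T x)) \<le> D"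
    using x commute[of z "T x"] unfolding D_def by linarith
  then have "d (T x) (T z) \<le> \<beta> * D"
    using contraction[OF x(1) \<open>z \<in> M\<close>] \<beta>_nonneg by (meson mult_left_mono order_trans)
  also have "\<dots> < D"
    using \<open>0 < D\<close> \<beta>_less_1 by simp
  finally have "max (d z (T x)) (d (T x) (T z)) < D"
    using x commute[of z "T x"] by simp
  moreover have "D \<le> max (d z (T x)) (d (T x) (T z))"
    unfolding D_def using x \<open>z \<in> M\<close> maps by (intro ultra) auto
  ultimately show False
    by linarith
qed

lemma fixed_point_exists:
  assumes "Metric_space.mcomplete M d"
  shows "\<exists>z\<in>M. T z = z"
proof -
  interpret Metric_space M d
    by (intro Ultrametric_space_imp_Metric_space Ultrametric_space_axioms)
  obtain x where x: "x \<in> M"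
    using nonempty by blast
  then obtain z where lim: "limitin mtopology (\<lambda>n. (T ^^ n) x) z sequentially"
    using assms orbit_MCauchy unfolding mcomplete_def by blast
  then have z: "z \<in> M"
    by (simp add: limitin_metric)
  have "T z = z"
  proof (rule fixed_if_well_approximated[OF z])
    fix \<epsilon> :: real assume "0 < \<epsilon>"
    then obtain N where "\<And>n. N \<le> n \<Longrightarrow> d ((T ^^ n) x) z < \<epsilon>"
      using lim unfolding limitin_metric eventually_sequentially by blast
    from this[of N] this[of "Suc N"] show "\<exists>y\<in>M. d y z < \<epsilon> \<and> d (T y) z < \<epsilon>"
      using orbit_in[OF x, of N] by auto
  qed
  with z show ?thesis ..
qed

text \<open>For two fixed points both distances in the contraction condition are the distance between
  them, which is therefore at most \<open>\<beta>\<close> times itself.\<close>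

lemma fixed_point_unique:
  assumes "x \<in> M" "T x = x" "y \<in> M" "T y = y"
  shows "x = y"
proof -
  have "d x y \<le> \<beta> * d x y"
    using contraction[of x y] assms commute[of y x] by simp
  then have "d x y \<le> \<beta> * 0"
    using absorb[of "d x y" 0] nonneg[of x y] by (simp add: max_def)
  then show ?thesis
    using assms zero[of x y] nonneg[of x y] by simp
qed

end

theorem corollary2p6:
  fixes M :: "'a set" and d :: "'a \<Rightarrow> 'a \<Rightarrow> real" and T :: "'a \<Rightarrow> 'a"
  assumes "Ultrametric_space M d"
    and "Metric_space.mcomplete M d"
    and "T \<in> M \<rightarrow> M"
    and "\<exists>\<beta>::real. 0 \<le> \<beta> \<and> \<beta> < 1 \<and>
           (\<forall>x\<in>M. \<forall>y\<in>M. d (T x) (T y) \<le> \<beta> * max (d x (T y)) (d y (T x)))"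
  shows "\<exists>!x. x \<in> M \<and> T x = x"
proof -
  obtain \<beta> :: real where \<beta>: "0 \<le> \<beta>" "\<beta> < 1"
    and contr: "\<forall>x\<in>M. \<forall>y\<in>M. d (T x) (T y) \<le> \<beta> * max (d x (T y)) (d y (T x))"
    using assms(4) by blast
  interpret Ultrametric_space M d by fact
  interpret ultrametric_Chatterjea_map M d T \<beta>
    using assms(3) \<beta> contr by unfold_locales auto
  show ?thesis
    using fixed_point_exists[OF assms(2)] fixed_point_unique by blast
qed

end
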